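(* There is a category isomorphism between the category of left restriction semigroups with range and the category of Ehresmann-ordered categories satisfying the following condition (OC4A): for all elements $s,t$ of the category, if $s\leq t$ and $D(s)=D(t)$, then $s=t$.
   Context: An Ehresmann semigroup is a semigroup $(S,\cdot)$ with unary operations $D,R$ such that for all $s,t\in S$: $D(s)s=s$, $sR(s)=s$; $D(R(s))=R(s)$, $R(D(s))=D(s)$; $D(st)=D(sD(t))$, $R(st)=R(R(s)t)$; $D(D(s)D(t))=D(s)D(t)$; $D(s)D(t)=D(t)D(s)$. A left restriction semigroup with range is an Ehresmann semigroup satisfying the law $sD(t)=D(st)s$. The arrows between left restriction semigroups with range are the Ehresmann semigroup homomorphisms: semigroup homomorphisms $F:S\to T$ with $D(s)F=D(sF)$ and $R(s)F=R(sF)$ for all $s\in S$. (Functions are written on the right.) A (small) category is a partial algebra $(C,\circ,D,R)$ with $\circ$ a partial binary operation and $D,R$ unary operations such that for all $x,y,z\in C$: $D(x)\circ x=x=x\circ R(x)$; $D(R(x))=R(x)$, $R(D(x))=D(x)$; $x\circ y$ is defined iff $R(x)=D(y)$; if $x\circ y$ is defined then $D(x\circ y)=D(x)$ and $R(x\circ y)=R(y)$; if $(x\circ y)\circ z$ and $x\circ(y\circ z)$ are defined they are equal. $D(C)=\{D(x)\mid x\in C\}=R(C)$ is the set of identities. An $\Omega$-structured category $(C,\circ,D,R,\leq)$ is a category with a partial order $\leq$ on $C$ such that $a\leq b$ implies $D(a)\leq D(b)$ and $R(a)\leq R(b)$; and if $a\leq b$, $c\leq d$ and both $a\circ c$, $b\circ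 d$ exist, then $a\circ c\leq b\circ d$. An Ehresmann-ordered category is an $\Omega$-structured category $(C,\circ,D,R,\leq)$ such that: (OC6) for all $x\in C$ and $e\in D(C)$ with $e\leq D(x)$, there is a greatest element $e|x=\max\{y\leq x\mid D(y)\leq e\}$, and $D(e|x)=e$; and for all $x\in C$ and $e\in D(C)$ with $e\leq R(x)$, there is a greatest element $x|e=\max\{y\leq x\mid R(y)\leq e\}$, and $R(x|e)=e$; (OC7') if $a\leq b\circ c$, then there are $b'\leq b$, $c'\leq c$ such that $D(a)=D(b')$, $R(a)=R(c')$, $b'\circ c'$ exists, and $a\leq b'\circ c'$; (OCI) if $a\in C$ and $a\leq e\in D(C)$, then $a\in D(C)$; and $(D(C),\leq)$ is a meet-semilattice (with meet $\wedge$). The arrows between Ehresmann-ordered categories are the functors $F:C_1\to C_2$ (maps preserving $D$, $R$ and all existing products $\circ$) such that: $s\leq t$ implies $sF\leq tF$; $(e\wedge f)F=eF\wedge fF$ for $e,f\in D(C_1)$; if $s\in C_1$, $e\in D(C_1)$ and $e\leq D(s)$ then $(e|s)F=(eF)|(sF)$, and dually if $f\in D(C_1)$ and $f\leq R(s)$ then $(s|f)F=(sF)|(fF)$. *)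

theory Defs
  imports "HOL-Library.FuncSet"
begin

text \<open>
  A structure has a carrier set inside an arbitrary type. Two structures that agree on their
  carriers have to be the same object, because an isomorphism of categories (and not merely an
  equivalence) is at stake. Hence all total operations, and all maps between structures, are
  extensional (\<open>undefined\<close> off the carrier), partial operations are \<open>None\<close> off the carrier, and
  order relations hold only between elements of the carrier. Empty carriers are allowed,
  for semigroups as well as for categories.
\<close>

record 'a domain_range =
  carrier :: "'a set"
  dm :: "'a \<Rightarrow> 'a"  (\<open>\<^bold>D\<index>\<close>)
  rg :: "'a \<Rightarrow> 'a"  (\<open>\<^bold>R\<index>\<close>)


section \<open>Left restriction semigroups with range\<close>

record 'a dr_semigroup = "'a domain_range" +
  mult :: "'a \<Rightarrow> 'a \<Rightarrow> 'a"  (infixl \<open>\<cdot>\<index>\<close> 70)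

locale ehresmann_semigroup =
  fixes S :: "'a dr_semigroup" (structure)
  assumes dm_funcset: "dm S \<in> carrier S \<rightarrow>\<^sub>E carrier S"
    and rg_funcset: "rg S \<in> carrier S \<rightarrow>\<^sub>E carrier S"
    and mult_funcset: "mult S \<in> carrier S \<rightarrow>\<^sub>E carrier S \<rightarrow>\<^sub>E carrier S"
    and assoc: "\<lbrakk>s \<in> carrier S; t \<in> carrier S; u \<in> carrier S\<rbrakk> \<Longrightarrow> (s \<cdot> t) \<cdot> u = s \<cdot> (t \<cdot> u)"
    and dm_left: "s \<in> carrier S \<Longrightarrow> \<^bold>D s \<cdot> s = s"
    and rg_right: "s \<in> carrier S \<Longrightarrow> s \<cdot> \<^bold>R s = s"
    and dm_rg: "s \<in> carrier S \<Longrightarrow> \<^bold>D (\<^bold>R s) = \<^bold>R s"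
    and rg_dm: "s \<in> carrier S \<Longrightarrow> \<^bold>R (\<^bold>D s) = \<^bold>D s"
    and dm_mult: "\<lbrakk>s \<in> carrier S; t \<in> carrier S\<rbrakk> \<Longrightarrow> \<^bold>D (s \<cdot> t) = \<^bold>D (s \<cdot> \<^bold>D t)"
    and rg_mult: "\<lbrakk>s \<in> carrier S; t \<in> carrier S\<rbrakk> \<Longrightarrow> \<^bold>R (s \<cdot> t) = \<^bold>R (\<^bold>R s \<cdot> t)"
    and dm_dm_mult: "\<lbrakk>s \<in> carrier S; t \<in> carrier S\<rbrakk> \<Longrightarrow> \<^bold>D (\<^bold>D s \<cdot> \<^bold>D t) = \<^bold>D s \<cdot> \<^bold>D t"
    and dm_commute: "\<lbrakk>s \<in> carrier S; t \<in> carrier S\<rbrakk> \<Longrightarrow> \<^bold>D s \<cdot> \<^bold>D t = \<^bold>D t \<cdot> \<^bold>D s"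

locale left_restriction_semigroup_with_range = ehresmann_semigroup +
  assumes left_restriction:
    "\<lbrakk>s \<in> carrier S; t \<in> carrier S\<rbrakk> \<Longrightarrow> s \<cdot> \<^bold>D t = \<^bold>D (s \<cdot> t) \<cdot> s"

definition ehresmann_hom :: "'a dr_semigroup \<Rightarrow> 'b dr_semigroup \<Rightarrow> ('a \<Rightarrow> 'b) set" where
  "ehresmann_hom S T = {F \<in> carrier S \<rightarrow>\<^sub>E carrier T.
     (\<forall>s\<in>carrier S. \<forall>t\<in>carrier S. F (s \<cdot>\<^bsub>S\<^esub> t) = F s \<cdot>\<^bsub>T\<^esub> F t) \<and>
     (\<forall>s\<in>carrier S. F (\<^bold>D\<^bsub>S\<^esub> s) = \<^bold>D\<^bsub>T\<^esub> (F s)) \<and>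
     (\<forall>s\<in>carrier S. F (\<^bold>R\<^bsub>S\<^esub> s) = \<^bold>R\<^bsub>T\<^esub> (F s))}"


section \<open>Ehresmann-ordered categories\<close>

text \<open>\<open>x \<odot> y = None\<close> means that the product of \<open>x\<close> and \<open>y\<close> is not defined.\<close>

record 'a ordered_category = "'a domain_range" +
  pcomp :: "'a \<Rightarrow> 'a \<Rightarrow> 'a option"  (infixl \<open>\<odot>\<index>\<close> 70)
  le :: "'a \<Rightarrow> 'a \<Rightarrow> bool"  (infix \<open>\<sqsubseteq>\<index>\<close> 50)

definition idents :: "'a ordered_category \<Rightarrow> 'a set" where
  "idents C = dm C ` carrier C"

definition is_greatest :: "'a ordered_category \<Rightarrow> 'a set \<Rightarrow> 'a \<Rightarrow> bool" where
  "is_greatest C A g \<longleftrightarrow> g \<in> A \<and> (\<forall>y\<in>A. y \<sqsubseteq>\<^bsub>C\<^esub> g)"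

text \<open>\<open>left_restr C e x\<close> and \<open>right_restr C x e\<close> are \<open>e|x\<close> and \<open>x|e\<close>; they are meaningful only
  if \<open>e \<sqsubseteq> \<^bold>D x\<close> and \<open>e \<sqsubseteq> \<^bold>R x\<close>, respectively.\<close>

definition left_restr :: "'a ordered_category \<Rightarrow> 'a \<Rightarrow> 'a \<Rightarrow> 'a" where
  "left_restr C e x =
     (THE g. is_greatest C {y \<in> carrier C. y \<sqsubseteq>\<^bsub>C\<^esub> x \<and> \<^bold>D\<^bsub>C\<^esub> y \<sqsubseteq>\<^bsub>C\<^esub> e} g)"

definition right_restr :: "'a ordered_category \<Rightarrow> 'a \<Rightarrow> 'a \<Rightarrow> 'a" where
  "right_restr C x e =
     (THE g. is_greatest C {y \<in> carrier C. y \<sqsubseteq>\<^bsub>C\<^esub> x \<and> \<^bold>R\<^bsub>C\<^esub> y \<sqsubseteq>\<^bsub>C\<^esub> e} g)"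

definition is_meet :: "'a ordered_category \<Rightarrow> 'a \<Rightarrow> 'a \<Rightarrow> 'a \<Rightarrow> bool" where
  "is_meet C e f g \<longleftrightarrow> is_greatest C {h \<in> idents C. h \<sqsubseteq>\<^bsub>C\<^esub> e \<and> h \<sqsubseteq>\<^bsub>C\<^esub> f} g"

definition ident_meet :: "'a ordered_category \<Rightarrow> 'a \<Rightarrow> 'a \<Rightarrow> 'a" where
  "ident_meet C e f = (THE g. is_meet C e f g)"

locale small_category =
  fixes C :: "'a ordered_category" (structure)
  assumes dm_funcset: "dm C \<in> carrier C \<rightarrow>\<^sub>E carrier C"
    and rg_funcset: "rg C \<in> carrier C \<rightarrow>\<^sub>E carrier C"
    and pcomp_carrier: "x \<odot> y = Some z \<Longrightarrow> x \<in> carrier C \<and> y \<in> carrier C \<and> z \<in> carrier C"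
    and dm_left: "x \<in> carrier C \<Longrightarrow> \<^bold>D x \<odot> x = Some x"
    and rg_right: "x \<in> carrier C \<Longrightarrow> x \<odot> \<^bold>R x = Some x"
    and dm_rg: "x \<in> carrier C \<Longrightarrow> \<^bold>D (\<^bold>R x) = \<^bold>R x"
    and rg_dm: "x \<in> carrier C \<Longrightarrow> \<^bold>R (\<^bold>D x) = \<^bold>D x"
    and pcomp_defined: "\<lbrakk>x \<in> carrier C; y \<in> carrier C\<rbrakk> \<Longrightarrow> x \<odot> y \<noteq> None \<longleftrightarrow> \<^bold>R x = \<^bold>D y"
    and dm_pcomp: "x \<odot> y = Some z \<Longrightarrow> \<^bold>D z = \<^bold>D x"
    and rg_pcomp: "x \<odot> y = Some z \<Longrightarrow> \<^bold>R z = \<^bold>R y"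
    and pcomp_assoc:
      "\<lbrakk>x \<odot> y = Some u; u \<odot> z = Some v; y \<odot> z = Some w; x \<odot> w = Some v'\<rbrakk> \<Longrightarrow> v = v'"

locale omega_structured_category = small_category +
  assumes le_carrier: "x \<sqsubseteq> y \<Longrightarrow> x \<in> carrier C \<and> y \<in> carrier C"
    and le_refl: "x \<in> carrier C \<Longrightarrow> x \<sqsubseteq> x"
    and le_antisym: "\<lbrakk>x \<sqsubseteq> y; y \<sqsubseteq> x\<rbrakk> \<Longrightarrow> x = y"
    and le_trans: "\<lbrakk>x \<sqsubseteq> y; y \<sqsubseteq> z\<rbrakk> \<Longrightarrow> x \<sqsubseteq> z"
    and dm_mono: "a \<sqsubseteq> b \<Longrightarrow> \<^bold>D a \<sqsubseteq> \<^bold>D b"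
    and rg_mono: "a \<sqsubseteq> b \<Longrightarrow> \<^bold>R a \<sqsubseteq> \<^bold>R b"
    and pcomp_mono: "\<lbrakk>a \<sqsubseteq> b; c \<sqsubseteq> d; a \<odot> c = Some p; b \<odot> d = Some q\<rbrakk> \<Longrightarrow> p \<sqsubseteq> q"

locale ehresmann_ordered_category = omega_structured_category +
  assumes OC6_left: "\<lbrakk>x \<in> carrier C; e \<in> idents C; e \<sqsubseteq> \<^bold>D x\<rbrakk> \<Longrightarrow>
      \<exists>g. is_greatest C {y \<in> carrier C. y \<sqsubseteq> x \<and> \<^bold>D y \<sqsubseteq> e} g \<and> \<^bold>D g = e"
    and OC6_right: "\<lbrakk>x \<in> carrier C; e \<in> idents C; e \<sqsubseteq> \<^bold>R x\<rbrakk> \<Longrightarrow>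
      \<exists>g. is_greatest C {y \<in> carrier C. y \<sqsubseteq> x \<and> \<^bold>R y \<sqsubseteq> e} g \<and> \<^bold>R g = e"
    and OC7': "\<lbrakk>b \<odot> c = Some d; a \<sqsubseteq> d\<rbrakk> \<Longrightarrow>
      \<exists>b' c' d'. b' \<sqsubseteq> b \<and> c' \<sqsubseteq> c \<and> \<^bold>D a = \<^bold>D b' \<and> \<^bold>R a = \<^bold>R c' \<and>
        b' \<odot> c' = Some d' \<and> a \<sqsubseteq> d'"
    and OCI: "\<lbrakk>a \<in> carrier C; e \<in> idents C; a \<sqsubseteq> e\<rbrakk> \<Longrightarrow> a \<in> idents C"
    and meets: "\<lbrakk>e \<in> idents C; f \<in> idents C\<rbrakk> \<Longrightarrow> \<exists>g. is_meet C e f g"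

locale ehresmann_ordered_category_OC4A = ehresmann_ordered_category +
  assumes OC4A: "\<lbrakk>s \<in> carrier C; t \<in> carrier C; s \<sqsubseteq> t; \<^bold>D s = \<^bold>D t\<rbrakk> \<Longrightarrow> s = t"

definition ehresmann_functors ::
    "'a ordered_category \<Rightarrow> 'b ordered_category \<Rightarrow> ('a \<Rightarrow> 'b) set" where
  "ehresmann_functors C1 C2 = {F \<in> carrier C1 \<rightarrow>\<^sub>E carrier C2.
     (\<forall>s\<in>carrier C1. F (\<^bold>D\<^bsub>C1\<^esub> s) = \<^bold>D\<^bsub>C2\<^esub> (F s)) \<and>
     (\<forall>s\<in>carrier C1. F (\<^bold>R\<^bsub>C1\<^esub> s) = \<^bold>R\<^bsub>C2\<^esub> (F s)) \<and>
     (\<forall>s t u. s \<odot>\<^bsub>C1\<^esub> t = Some u \<longrightarrow> F s \<odot>\<^bsub>C2\<^esub> F t = Some (F u)) \<and>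
     (\<forall>s\<in>carrier C1. \<forall>t\<in>carrier C1. s \<sqsubseteq>\<^bsub>C1\<^esub> t \<longrightarrow> F s \<sqsubseteq>\<^bsub>C2\<^esub> F t) \<and>
     (\<forall>e\<in>idents C1. \<forall>f\<in>idents C1. F (ident_meet C1 e f) = ident_meet C2 (F e) (F f)) \<and>
     (\<forall>s\<in>carrier C1. \<forall>e\<in>idents C1. e \<sqsubseteq>\<^bsub>C1\<^esub> \<^bold>D\<^bsub>C1\<^esub> s \<longrightarrow>
        F (left_restr C1 e s) = left_restr C2 (F e) (F s)) \<and>
     (\<forall>s\<in>carrier C1. \<forall>f\<in>idents C1. f \<sqsubseteq>\<^bsub>C1\<^esub> \<^bold>R\<^bsub>C1\<^esub> s \<longrightarrow>
        F (right_restr C1 s f) = right_restr C2 (F s) (F f))}"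


section \<open>Categories of structures and their isomorphisms\<close>

text \<open>Composition is in diagrammatic order: \<open>Comp \<C> f g\<close> is \<open>f\<close> followed by \<open>g\<close>.\<close>

record ('o, 'm) cat =
  Obj :: "'o set"
  Arr :: "'m set"
  Dom :: "'m \<Rightarrow> 'o"
  Cod :: "'m \<Rightarrow> 'o"
  Ide :: "'o \<Rightarrow> 'm"
  Comp :: "'m \<Rightarrow> 'm \<Rightarrow> 'm"

locale category =
  fixes \<C> :: "('o, 'm) cat"
  assumes Dom_Obj: "f \<in> Arr \<C> \<Longrightarrow> Dom \<C> f \<in> Obj \<C>"
    and Cod_Obj: "f \<in> Arr \<C> \<Longrightarrow> Cod \<C> f \<in> Obj \<C>"
    and Ide_Arr: "X \<in> Obj \<C> \<Longrightarrow> Ide \<C> X \<in> Arr \<C>"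
    and Dom_Ide: "X \<in> Obj \<C> \<Longrightarrow> Dom \<C> (Ide \<C> X) = X"
    and Cod_Ide: "X \<in> Obj \<C> \<Longrightarrow> Cod \<C> (Ide \<C> X) = X"
    and Comp_Arr: "\<lbrakk>f \<in> Arr \<C>; g \<in> Arr \<C>; Cod \<C> f = Dom \<C> g\<rbrakk> \<Longrightarrow> Comp \<C> f g \<in> Arr \<C>"
    and Dom_Comp: "\<lbrakk>f \<in> Arr \<C>; g \<in> Arr \<C>; Cod \<C> f = Dom \<C> g\<rbrakk> \<Longrightarrow> Dom \<C> (Comp \<C> f g) = Dom \<C> f"
    and Cod_Comp: "\<lbrakk>f \<in> Arr \<C>; g \<in> Arr \<C>; Cod \<C> f = Dom \<C> g\<rbrakk> \<Longrightarrow> Cod \<C> (Comp \<C> f g) = Cod \<C> g"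
    and Comp_Ide_left: "f \<in> Arr \<C> \<Longrightarrow> Comp \<C> (Ide \<C> (Dom \<C> f)) f = f"
    and Comp_Ide_right: "f \<in> Arr \<C> \<Longrightarrow> Comp \<C> f (Ide \<C> (Cod \<C> f)) = f"
    and Comp_assoc: "\<lbrakk>f \<in> Arr \<C>; g \<in> Arr \<C>; h \<in> Arr \<C>; Cod \<C> f = Dom \<C> g; Cod \<C> g = Dom \<C> h\<rbrakk>
      \<Longrightarrow> Comp \<C> (Comp \<C> f g) h = Comp \<C> f (Comp \<C> g h)"

locale category_functor = A: category \<A> + B: category \<B>
  for \<A> :: "('o, 'm) cat" and \<B> :: "('p, 'n) cat" +
  fixes Fo :: "'o \<Rightarrow> 'p" and Fa :: "'m \<Rightarrow> 'n"
  assumes Fo_Obj: "X \<in> Obj \<A> \<Longrightarrow> Fo X \<in> Obj \<B>"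
    and Fa_Arr: "f \<in> Arr \<A> \<Longrightarrow> Fa f \<in> Arr \<B>"
    and Dom_Fa: "f \<in> Arr \<A> \<Longrightarrow> Dom \<B> (Fa f) = Fo (Dom \<A> f)"
    and Cod_Fa: "f \<in> Arr \<A> \<Longrightarrow> Cod \<B> (Fa f) = Fo (Cod \<A> f)"
    and Fa_Ide: "X \<in> Obj \<A> \<Longrightarrow> Fa (Ide \<A> X) = Ide \<B> (Fo X)"
    and Fa_Comp: "\<lbrakk>f \<in> Arr \<A>; g \<in> Arr \<A>; Cod \<A> f = Dom \<A> g\<rbrakk>
      \<Longrightarrow> Fa (Comp \<A> f g) = Comp \<B> (Fa f) (Fa g)"

locale category_isomorphism =
  F: category_functor \<A> \<B> Fo Fa + G: category_functor \<B> \<A> Go Ga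
  for \<A> :: "('o, 'm) cat" and \<B> :: "('p, 'n) cat" and Fo Fa Go Ga +
  assumes Go_Fo: "X \<in> Obj \<A> \<Longrightarrow> Go (Fo X) = X"
    and Ga_Fa: "f \<in> Arr \<A> \<Longrightarrow> Ga (Fa f) = f"
    and Fo_Go: "Y \<in> Obj \<B> \<Longrightarrow> Fo (Go Y) = Y"
    and Fa_Ga: "g \<in> Arr \<B> \<Longrightarrow> Fa (Ga g) = g"

text \<open>The category with the given objects and, as arrows from \<open>S\<close> to \<open>T\<close>, the maps in \<open>hom S T\<close>.
  An arrow carries its domain and codomain.\<close>

definition structure_cat ::
    "('a, 'r) domain_range_scheme set
      \<Rightarrow> (('a, 'r) domain_range_scheme \<Rightarrow> ('a, 'r) domain_range_scheme \<Rightarrow> ('a \<Rightarrow> 'a) set)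
      \<Rightarrow> (('a, 'r) domain_range_scheme,
          ('a, 'r) domain_range_scheme \<times> ('a \<Rightarrow> 'a) \<times> ('a, 'r) domain_range_scheme) cat" where
  "structure_cat obs hom =
     \<lparr>Obj = obs,
      Arr = {(S, F, T). S \<in> obs \<and> T \<in> obs \<and> F \<in> hom S T},
      Dom = (\<lambda>(S, F, T). S),
      Cod = (\<lambda>(S, F, T). T),
      Ide = (\<lambda>S. (S, restrict (\<lambda>x. x) (carrier S), S)),
      Comp = (\<lambda>(S, F, T) (T', G, U). (S, compose (carrier S) G F, U))\<rparr>"

type_synonym 'a lrsr_cat =
  "('a dr_semigroup, 'a dr_semigroup \<times> ('a \<Rightarrow> 'a) \<times> 'a dr_semigroup) cat"

type_synonym 'a eoc_cat =
  "('a ordered_category, 'a ordered_category \<times> ('a \<Rightarrow> 'a) \<times> 'a ordered_category) cat"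

definition left_restriction_semigroups_with_range :: "'a lrsr_cat" where
  "left_restriction_semigroups_with_range =
     structure_cat {S. left_restriction_semigroup_with_range S} ehresmann_hom"

definition ehresmann_ordered_categories_OC4A :: "'a eoc_cat" where
  "ehresmann_ordered_categories_OC4A =
     structure_cat {C. ehresmann_ordered_category_OC4A C} ehresmann_functors"

end

theory Submission
  imports Defs
begin

text \<open>
  A left restriction semigroup with range and an Ehresmann-ordered category satisfying (OC4A) are
  two presentations of the same data on the same set. From the semigroup one obtains the category
  by keeping only the products \<open>s \<cdot> t\<close> with \<open>R(s) = D(t)\<close> and recording the rest in the order
  \<open>s \<le> t \<longleftrightarrow> s = D(s) \<cdot> t\<close>. In this order the meet of two projections is their product, and the
  restrictions are \<open>e|x = e \<cdot> x\<close> and \<open>x|e = x \<cdot> e\<close>; the left restriction law is what puts \<open>x \<cdot> e\<close>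
  below \<open>x\<close> and what makes the order compatible with products.

  From the category one recovers the semigroup by \<open>s \<star> t = (s|e) \<circ> (e|t)\<close> with
  \<open>e = R(s) \<and> D(t)\<close>. The key point is an order-theoretic description of this product: \<open>s \<star> t\<close>
  is the greatest of all composites \<open>p \<circ> q\<close> with \<open>p \<le> s\<close> and \<open>q \<le> t\<close> (\<open>prod_factors\<close>,
  \<open>pcomp_le_prod\<close>). In the presence of (OC4A), axiom (OC7') says that everything below a
  composite is a composite of elements below the factors (\<open>le_pcomp_factors\<close>). Hence both
  bracketings of a triple product are the greatest composite \<open>p \<circ> q \<circ> r\<close> with \<open>p \<le> s\<close>, \<open>q \<le> t\<close>,
  \<open>r \<le> u\<close>, which gives associativity. (OC4A) also yields the left restriction law: \<open>s|e\<close> lies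
  below \<open>s\<close>, and an element below \<open>s\<close> is determined by its domain.

  The two constructions undo each other on the nose. The semigroup homomorphisms from \<open>S\<close> to \<open>T\<close>
  and the functors between the corresponding categories are literally the same maps, because meets
  and restrictions are products in \<open>S\<close>, and conversely every product is a composite of
  restrictions (\<open>ehresmann_functors_category_of\<close>). The isomorphism of categories
  therefore leaves the underlying maps of the arrows unchanged.
\<close>

section \<open>From semigroups to ordered categories\<close>

definition category_of :: "'a dr_semigroup \<Rightarrow> 'a ordered_category" where
  "category_of S = \<lparr>carrier = carrier S, dm = dm S, rg = rg S,
     pcomp = (\<lambda>s t. if s \<in> carrier S \<and> t \<in> carrier S \<and> rg S s = dm S t
                    then Some (mult S s t) else None),
     le = (\<lambda>s t. s \<in> carrier S \<and> t \<in> carrier S \<and> s = mult S (dm S s) t)\<rparr>"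

lemma category_of_simps [simp]:
  "carrier (category_of S) = carrier S"
  "dm (category_of S) = dm S"
  "rg (category_of S) = rg S"
  "s \<odot>\<^bsub>category_of S\<^esub> t = Some u \<longleftrightarrow>
     s \<in> carrier S \<and> t \<in> carrier S \<and> rg S s = dm S t \<and> u = mult S s t"
  "s \<odot>\<^bsub>category_of S\<^esub> t = None \<longleftrightarrow> \<not> (s \<in> carrier S \<and> t \<in> carrier S \<and> rg S s = dm S t)"
  "s \<sqsubseteq>\<^bsub>category_of S\<^esub> t \<longleftrightarrow> s \<in> carrier S \<and> t \<in> carrier S \<and> s = mult S (dm S s) t"
  "idents (category_of S) = dm S ` carrier S"
  by (auto simp: category_of_def idents_def)

context ehresmann_semigroup
begin

lemma closed [simp]:
  "s \<in> carrier S \<Longrightarrow> \<^bold>D s \<in> carrier S"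
  "s \<in> carrier S \<Longrightarrow> \<^bold>R s \<in> carrier S"
  "s \<in> carrier S \<Longrightarrow> t \<in> carrier S \<Longrightarrow> s \<cdot> t \<in> carrier S"
  using dm_funcset rg_funcset mult_funcset by (auto simp: PiE_iff)

lemma dm_dm [simp]: "s \<in> carrier S \<Longrightarrow> \<^bold>D (\<^bold>D s) = \<^bold>D s"
  by (metis closed(1) dm_rg rg_dm)

text \<open>
  The projections of \<open>S\<close>, which are the identities of \<open>category_of S\<close>, are the fixed points of
  \<open>D\<close>. Lemmas about projections are stated for elements with \<open>D(e) = e\<close>.
\<close>

lemma proj_iff: "e \<in> dm S ` carrier S \<longleftrightarrow> e \<in> carrier S \<and> \<^bold>D e = e"
  by (auto intro: image_eqI[of e "dm S" e])

lemma rg_proj: "e \<in> carrier S \<Longrightarrow> \<^bold>D e = e \<Longrightarrow> \<^bold>R e = e"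
  by (metis rg_dm)

lemma proj_idem: "e \<in> carrier S \<Longrightarrow> \<^bold>D e = e \<Longrightarrow> e \<cdot> e = e"
  by (metis dm_left)

lemma proj_commute:
  "e \<in> carrier S \<Longrightarrow> f \<in> carrier S \<Longrightarrow> \<^bold>D e = e \<Longrightarrow> \<^bold>D f = f \<Longrightarrow> e \<cdot> f = f \<cdot> e"
  by (metis dm_commute)

lemma dm_proj_mult:
  assumes "e \<in> carrier S" "t \<in> carrier S" "\<^bold>D e = e"
  shows "\<^bold>D (e \<cdot> t) = e \<cdot> \<^bold>D t"
  using assms by (metis dm_mult dm_dm_mult)

lemma rg_mult_proj:
  assumes "s \<in> carrier S" "f \<in> carrier S" "\<^bold>D f = f"
  shows "\<^bold>R (s \<cdot> f) = \<^bold>R s \<cdot> f"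
proof -
  have "\<^bold>D (\<^bold>R s \<cdot> f) = \<^bold>R s \<cdot> f"
    using assms dm_dm_mult[of "\<^bold>R s" f] by (simp add: dm_rg)
  then show ?thesis
    using assms rg_mult[of s f] rg_proj[of "\<^bold>R s \<cdot> f"] by simp
qed

text \<open>
  This says \<open>R(s \<cdot> t) \<le> R(t)\<close>, because \<open>s \<cdot> t\<close> absorbs \<open>R(t)\<close> on the right. Since \<open>a \<le> b\<close> means
  that \<open>a\<close> is a left multiple of \<open>b\<close> by a projection, it gives the monotonicity of \<open>R\<close>.
\<close>

lemma rg_mult_absorb:
  assumes "s \<in> carrier S" "t \<in> carrier S"
  shows "\<^bold>R (s \<cdot> t) \<cdot> \<^bold>R t = \<^bold>R (s \<cdot> t)"
proof -
  have "\<^bold>R (s \<cdot> t) = \<^bold>R ((s \<cdot> t) \<cdot> \<^bold>R t)"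
    using assms by (simp add: assoc rg_right)
  also have "\<dots> = \<^bold>R (s \<cdot> t) \<cdot> \<^bold>R t"
    using assms by (simp add: rg_mult_proj dm_rg)
  finally show ?thesis by simp
qed

text \<open>
  The order could equally be defined by \<open>s = e \<cdot> t\<close> for some projection \<open>e\<close>, which
  need not be \<open>D(s)\<close>. This form is the easier one to establish.
\<close>

lemma proj_mult_le:
  assumes "e \<in> carrier S" "t \<in> carrier S" "\<^bold>D e = e"
  shows "e \<cdot> t \<sqsubseteq>\<^bsub>category_of S\<^esub> t"
  using assms by (simp add: dm_proj_mult assoc dm_left)

text \<open>
  Every product is a composite in the category: replacing \<open>s\<close> and \<open>t\<close> by their restrictions to
  \<open>R(s) \<cdot> D(t)\<close> does not change \<open>s \<cdot> t\<close>, since \<open>R(s)\<close> is absorbed by \<open>s\<close>, \<open>D(t)\<close> by \<open>t\<close>, and the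
  two projections commute.
\<close>

lemma mult_via_meet:
  assumes "s \<in> carrier S" "t \<in> carrier S"
  shows "(s \<cdot> (\<^bold>R s \<cdot> \<^bold>D t)) \<cdot> ((\<^bold>R s \<cdot> \<^bold>D t) \<cdot> t) = s \<cdot> t"
proof -
  have "s \<cdot> (\<^bold>R s \<cdot> \<^bold>D t) = s \<cdot> \<^bold>D t"
    using assms by (simp add: assoc[symmetric] rg_right)
  moreover have "(\<^bold>R s \<cdot> \<^bold>D t) \<cdot> t = \<^bold>R s \<cdot> t"
    using assms by (simp add: assoc dm_left)
  moreover have "\<^bold>D t \<cdot> (\<^bold>R s \<cdot> t) = \<^bold>R s \<cdot> t"
  proof -
    have "\<^bold>D t \<cdot> \<^bold>R s = \<^bold>R s \<cdot> \<^bold>D t"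
      using assms by (intro proj_commute) (auto simp: dm_rg)
    then show ?thesis
      using assms by (simp add: assoc dm_left flip: assoc[of "\<^bold>D t" "\<^bold>R s" t])
  qed
  moreover have "s \<cdot> (\<^bold>R s \<cdot> t) = s \<cdot> t"
    using assms by (simp add: assoc[symmetric] rg_right)
  ultimately show ?thesis
    using assms by (simp add: assoc)
qed

lemma small_category_of: "small_category (category_of S)"
proof unfold_locales
  fix x y z u v w v'
  assume "x \<odot>\<^bsub>category_of S\<^esub> y = Some u" "u \<odot>\<^bsub>category_of S\<^esub> z = Some v"
    "y \<odot>\<^bsub>category_of S\<^esub> z = Some w" "x \<odot>\<^bsub>category_of S\<^esub> w = Some v'"
  then show "v = v'" by (auto simp: assoc)
next
  fix x y z
  assume "x \<odot>\<^bsub>category_of S\<^esub> y = Some z"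
  then have xy: "x \<in> carrier S" "y \<in> carrier S" "\<^bold>R x = \<^bold>D y" "z = x \<cdot> y" by auto
  show "\<^bold>D\<^bsub>category_of S\<^esub> z = \<^bold>D\<^bsub>category_of S\<^esub> x"
    using xy by simp (metis dm_mult rg_right)
  show "\<^bold>R\<^bsub>category_of S\<^esub> z = \<^bold>R\<^bsub>category_of S\<^esub> y"
    using xy by simp (metis rg_mult dm_left)
qed (use dm_funcset rg_funcset in \<open>auto simp: dm_left rg_right dm_rg rg_dm\<close>)

end

context left_restriction_semigroup_with_range
begin

lemma le_category_of_trans:
  assumes "x \<sqsubseteq>\<^bsub>category_of S\<^esub> y" "y \<sqsubseteq>\<^bsub>category_of S\<^esub> z"
  shows "x \<sqsubseteq>\<^bsub>category_of S\<^esub> z"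
proof -
  have c: "x \<in> carrier S" "y \<in> carrier S" "z \<in> carrier S"
    and xy: "x = \<^bold>D x \<cdot> y" and yz: "y = \<^bold>D y \<cdot> z"
    using assms by auto
  have "x = (\<^bold>D x \<cdot> \<^bold>D y) \<cdot> z"
    using c xy yz by (metis assoc closed(1))
  moreover have "(\<^bold>D x \<cdot> \<^bold>D y) \<cdot> z \<sqsubseteq>\<^bsub>category_of S\<^esub> z"
    using c by (intro proj_mult_le) (auto simp: dm_dm_mult)
  ultimately show ?thesis by simp
qed

text \<open>
  The left restriction law moves the projection \<open>D(c)\<close>, which separates \<open>b\<close> from \<open>d\<close> in
  \<open>a \<cdot> c = D(a) \<cdot> b \<cdot> D(c) \<cdot> d\<close>, to the left of \<open>b\<close>.
\<close>

lemma mult_mono: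
  assumes "a \<sqsubseteq>\<^bsub>category_of S\<^esub> b" "c \<sqsubseteq>\<^bsub>category_of S\<^esub> d"
  shows "a \<cdot> c \<sqsubseteq>\<^bsub>category_of S\<^esub> b \<cdot> d"
proof -
  have car: "a \<in> carrier S" "b \<in> carrier S" "c \<in> carrier S" "d \<in> carrier S"
    and ab: "a = \<^bold>D a \<cdot> b" and cd: "c = \<^bold>D c \<cdot> d"
    using assms by auto
  let ?e = "\<^bold>D (b \<cdot> c)"
  have "a \<cdot> c = (\<^bold>D a \<cdot> b) \<cdot> (\<^bold>D c \<cdot> d)"
    using ab cd by simp
  also have "\<dots> = \<^bold>D a \<cdot> ((b \<cdot> \<^bold>D c) \<cdot> d)"
    using car by (simp add: assoc)
  also have "\<dots> = (\<^bold>D a \<cdot> ?e) \<cdot> (b \<cdot> d)"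
    using car by (simp add: left_restriction[of b c] assoc)
  finally have "a \<cdot> c = (\<^bold>D a \<cdot> ?e) \<cdot> (b \<cdot> d)" .
  moreover have "(\<^bold>D a \<cdot> ?e) \<cdot> (b \<cdot> d) \<sqsubseteq>\<^bsub>category_of S\<^esub> b \<cdot> d"
    using car by (intro proj_mult_le) (auto simp: dm_dm_mult)
  ultimately show ?thesis by simp
qed

lemma omega_structured_category_of: "omega_structured_category (category_of S)"
proof -
  interpret small_category "category_of S" by (rule small_category_of)
  show ?thesis
  proof unfold_locales
    fix a b assume ab: "a \<sqsubseteq>\<^bsub>category_of S\<^esub> b"
    then have car: "a \<in> carrier S" "b \<in> carrier S" and eq: "a = \<^bold>D a \<cdot> b" by auto
    have "\<^bold>D a = \<^bold>D a \<cdot> \<^bold>D b"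
      using car eq by (metis dm_proj_mult closed(1) dm_dm)
    with car show "\<^bold>D\<^bsub>category_of S\<^esub> a \<sqsubseteq>\<^bsub>category_of S\<^esub> \<^bold>D\<^bsub>category_of S\<^esub> b" by simp
    have "\<^bold>R a = \<^bold>R a \<cdot> \<^bold>R b"
      using car eq by (metis rg_mult_absorb closed(1))
    with car show "\<^bold>R\<^bsub>category_of S\<^esub> a \<sqsubseteq>\<^bsub>category_of S\<^esub> \<^bold>R\<^bsub>category_of S\<^esub> b"
      by (simp add: ehresmann_semigroup.dm_rg[OF ehresmann_semigroup_axioms])
  next
    fix x y assume "x \<sqsubseteq>\<^bsub>category_of S\<^esub> y" "y \<sqsubseteq>\<^bsub>category_of S\<^esub> x"
    then have car: "x \<in> carrier S" "y \<in> carrier S" and eq: "x = \<^bold>D x \<cdot> y" "y = \<^bold>D y \<cdot> x" by auto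
    then have "\<^bold>D x = \<^bold>D x \<cdot> \<^bold>D y" "\<^bold>D y = \<^bold>D y \<cdot> \<^bold>D x"
      by (metis dm_proj_mult closed(1) dm_dm)+
    then have "\<^bold>D x = \<^bold>D y" using car dm_commute by metis
    then show "x = y" using car eq
      by (metis ehresmann_semigroup.dm_left[OF ehresmann_semigroup_axioms])
  next
    fix a b c d p q
    assume "a \<sqsubseteq>\<^bsub>category_of S\<^esub> b" "c \<sqsubseteq>\<^bsub>category_of S\<^esub> d"
      "a \<odot>\<^bsub>category_of S\<^esub> c = Some p" "b \<odot>\<^bsub>category_of S\<^esub> d = Some q"
    then show "p \<sqsubseteq>\<^bsub>category_of S\<^esub> q"
      using mult_mono unfolding category_of_simps(4) by blast
  next
    fix x y z assume "x \<sqsubseteq>\<^bsub>category_of S\<^esub> y" "y \<sqsubseteq>\<^bsub>category_of S\<^esub> z"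
    then show "x \<sqsubseteq>\<^bsub>category_of S\<^esub> z" by (rule le_category_of_trans)
  qed (simp_all add: ehresmann_semigroup.dm_left[OF ehresmann_semigroup_axioms])
qed

text \<open>
  For a projection \<open>e \<le> D(x)\<close>, the greatest element \<open>e|x\<close> of (OC6) is \<open>e \<cdot> x\<close>: an element
  \<open>y = D(y) \<cdot> x\<close> with \<open>D(y) \<le> e\<close> equals \<open>D(y) \<cdot> (e \<cdot> x)\<close>.
\<close>

lemma greatest_left:
  assumes "x \<in> carrier S" "e \<in> carrier S" "\<^bold>D e = e" "e \<cdot> \<^bold>D x = e"
  shows "is_greatest (category_of S)
    {y \<in> carrier S. y \<sqsubseteq>\<^bsub>category_of S\<^esub> x \<and> \<^bold>D y \<sqsubseteq>\<^bsub>category_of S\<^esub> e} (e \<cdot> x) \<and> \<^bold>D (e \<cdot> x) = e"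
proof -
  have D: "\<^bold>D (e \<cdot> x) = e" using assms by (simp add: dm_proj_mult)
  have "y = \<^bold>D y \<cdot> (e \<cdot> x)"
    if "y \<in> carrier S" "y = \<^bold>D y \<cdot> x" "\<^bold>D y = \<^bold>D y \<cdot> e" for y
    using that assms by (metis assoc closed(1))
  then show ?thesis
    using assms D proj_mult_le[of e x] by (auto simp: is_greatest_def proj_idem)
qed

lemma mult_proj_le:
  assumes "x \<in> carrier S" "f \<in> carrier S" "\<^bold>D f = f"
  shows "x \<cdot> f \<sqsubseteq>\<^bsub>category_of S\<^esub> x"
proof -
  have "x \<cdot> f = \<^bold>D (x \<cdot> f) \<cdot> x" using assms by (metis left_restriction)
  then show ?thesis using assms by auto
qed

text \<open>
  Dually, \<open>x|e\<close> is \<open>x \<cdot> e\<close>: an element \<open>y \<le> x\<close> with \<open>R(y) \<le> e\<close> absorbs \<open>e\<close> on the right, so that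
  \<open>y = D(y) \<cdot> x\<close> implies \<open>y = D(y) \<cdot> (x \<cdot> e)\<close>.
\<close>

lemma greatest_right:
  assumes "x \<in> carrier S" "e \<in> carrier S" "\<^bold>D e = e" "e \<cdot> \<^bold>R x = e"
  shows "is_greatest (category_of S)
    {y \<in> carrier S. y \<sqsubseteq>\<^bsub>category_of S\<^esub> x \<and> \<^bold>R y \<sqsubseteq>\<^bsub>category_of S\<^esub> e} (x \<cdot> e) \<and> \<^bold>R (x \<cdot> e) = e"
proof -
  have R: "\<^bold>R (x \<cdot> e) = e"
    using assms by (simp add: rg_mult_proj) (metis closed(2) dm_rg proj_commute)
  have "y = \<^bold>D y \<cdot> (x \<cdot> e)"
    if "y \<in> carrier S" "y = \<^bold>D y \<cdot> x" "\<^bold>R y = \<^bold>R y \<cdot> e" for y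
  proof -
    have "y = y \<cdot> e" using that assms by (metis assoc closed(2) rg_right)
    then show ?thesis using that assms by (metis assoc closed(1))
  qed
  then show ?thesis
    using assms R mult_proj_le[of x e] by (auto simp: is_greatest_def dm_rg proj_idem)
qed

lemma is_meet_mult:
  assumes "e \<in> carrier S" "\<^bold>D e = e" "f \<in> carrier S" "\<^bold>D f = f"
  shows "is_meet (category_of S) e f (e \<cdot> f)"
proof -
  have "\<^bold>D (e \<cdot> f) = e \<cdot> f" using assms by (metis dm_dm_mult)
  moreover have "e \<cdot> f = (e \<cdot> f) \<cdot> e" "e \<cdot> f = (e \<cdot> f) \<cdot> f"
    using assms by (metis assoc proj_commute proj_idem)+
  moreover have "h = h \<cdot> (e \<cdot> f)" if "h \<in> carrier S" "h = h \<cdot> e" "h = h \<cdot> f" for h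
    using that assms by (metis assoc)
  ultimately show ?thesis
    using assms unfolding is_meet_def is_greatest_def by (auto simp: proj_iff)
qed

lemma ehresmann_ordered_category_of: "ehresmann_ordered_category_OC4A (category_of S)"
proof -
  interpret C: omega_structured_category "category_of S" by (rule omega_structured_category_of)
  show ?thesis
  proof unfold_locales
    fix x e
    assume "x \<in> carrier (category_of S)" "e \<in> idents (category_of S)"
      "e \<sqsubseteq>\<^bsub>category_of S\<^esub> \<^bold>D\<^bsub>category_of S\<^esub> x"
    then have "x \<in> carrier S" "e \<in> carrier S" "\<^bold>D e = e" "e \<cdot> \<^bold>D x = e"
      by (auto simp: proj_iff simp del: image_iff)
    from greatest_left[OF this] show "\<exists>g. is_greatest (category_of S)
        {y \<in> carrier (category_of S). y \<sqsubseteq>\<^bsub>category_of S\<^esub> x \<and>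
          \<^bold>D\<^bsub>category_of S\<^esub> y \<sqsubseteq>\<^bsub>category_of S\<^esub> e} g \<and> \<^bold>D\<^bsub>category_of S\<^esub> g = e"
      unfolding category_of_simps(1,2) by blast
  next
    fix x e
    assume "x \<in> carrier (category_of S)" "e \<in> idents (category_of S)"
      "e \<sqsubseteq>\<^bsub>category_of S\<^esub> \<^bold>R\<^bsub>category_of S\<^esub> x"
    then have "x \<in> carrier S" "e \<in> carrier S" "\<^bold>D e = e" "e \<cdot> \<^bold>R x = e"
      by (auto simp: proj_iff simp del: image_iff)
    from greatest_right[OF this] show "\<exists>g. is_greatest (category_of S)
        {y \<in> carrier (category_of S). y \<sqsubseteq>\<^bsub>category_of S\<^esub> x \<and>
          \<^bold>R\<^bsub>category_of S\<^esub> y \<sqsubseteq>\<^bsub>category_of S\<^esub> e} g \<and> \<^bold>R\<^bsub>category_of S\<^esub> g = e"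
      unfolding category_of_simps(1,3) by blast
  next
    fix a b c d
    assume "b \<odot>\<^bsub>category_of S\<^esub> c = Some d" "a \<sqsubseteq>\<^bsub>category_of S\<^esub> d"
    then have car: "a \<in> carrier S" "b \<in> carrier S" "c \<in> carrier S"
      and bc: "\<^bold>R b = \<^bold>D c" and a: "a = \<^bold>D a \<cdot> (b \<cdot> c)" by auto
    \<comment> \<open>For (OC7'), cut \<open>b\<close> down to the domain of \<open>a\<close>, and then \<open>c\<close> to the range of the result;
      the composite of the two is \<open>a\<close> itself.\<close>
    let ?b = "\<^bold>D a \<cdot> b" and ?c = "\<^bold>R (\<^bold>D a \<cdot> b) \<cdot> c"
    have ab: "?b \<cdot> c = a" using car a by (simp add: assoc)
    have Db: "\<^bold>D ?b = \<^bold>D a"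
      by (metis ab bc car closed(1,3) dm_mult rg_mult_absorb assoc rg_right)
    have "\<^bold>R ?b \<cdot> \<^bold>D c = \<^bold>R ?b"
      using rg_mult_absorb[of "\<^bold>D a" b] car bc by simp
    then have Dc: "\<^bold>D ?c = \<^bold>R ?b"
      using car by (simp add: dm_proj_mult dm_rg)
    have Rc: "\<^bold>R ?c = \<^bold>R a"
      using car ab by (metis rg_mult closed(1,3))
    have prod: "?b \<cdot> ?c = a"
      using car ab by (metis assoc closed rg_right)
    show "\<exists>b' c' d'. b' \<sqsubseteq>\<^bsub>category_of S\<^esub> b \<and> c' \<sqsubseteq>\<^bsub>category_of S\<^esub> c \<and>
        \<^bold>D\<^bsub>category_of S\<^esub> a = \<^bold>D\<^bsub>category_of S\<^esub> b' \<and> \<^bold>R\<^bsub>category_of S\<^esub> a = \<^bold>R\<^bsub>category_of S\<^esub> c' \<and>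
        b' \<odot>\<^bsub>category_of S\<^esub> c' = Some d' \<and> a \<sqsubseteq>\<^bsub>category_of S\<^esub> d'"
    proof (intro exI conjI)
      show "?b \<sqsubseteq>\<^bsub>category_of S\<^esub> b" "?c \<sqsubseteq>\<^bsub>category_of S\<^esub> c"
        using car by (auto intro!: proj_mult_le simp: dm_rg simp del: category_of_simps(6))
      show "?b \<odot>\<^bsub>category_of S\<^esub> ?c = Some a"
        using car Dc prod by simp
      show "a \<sqsubseteq>\<^bsub>category_of S\<^esub> a" using car C.le_refl[of a] by simp
    qed (use Db Rc in simp_all)
  next
    fix a e
    assume "a \<in> carrier (category_of S)" "e \<in> idents (category_of S)" "a \<sqsubseteq>\<^bsub>category_of S\<^esub> e"
    then have "a \<in> carrier S" "e \<in> carrier S" "\<^bold>D e = e" "a = \<^bold>D a \<cdot> e"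
      by (auto simp: proj_iff simp del: image_iff)
    then have "\<^bold>D a = a" by (metis dm_dm_mult)
    with \<open>a \<in> carrier S\<close> show "a \<in> idents (category_of S)" by (simp add: proj_iff del: image_iff)
  next
    fix e f assume "e \<in> idents (category_of S)" "f \<in> idents (category_of S)"
    then show "\<exists>g. is_meet (category_of S) e f g"
      using is_meet_mult[of e f] by (auto simp: proj_iff simp del: image_iff)
  next
    fix s t
    assume "s \<in> carrier (category_of S)" "t \<in> carrier (category_of S)"
      "s \<sqsubseteq>\<^bsub>category_of S\<^esub> t" "\<^bold>D\<^bsub>category_of S\<^esub> s = \<^bold>D\<^bsub>category_of S\<^esub> t"
    then show "s = t" by (simp add: dm_left)
  qed
qed

end

section \<open>From ordered categories to semigroups\<close>

context omega_structured_category
begin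

lemma is_greatest_unique: "is_greatest C A g \<Longrightarrow> is_greatest C A g' \<Longrightarrow> g = g'"
  by (auto simp: is_greatest_def intro: le_antisym)

lemma left_restr_eq:
  "is_greatest C {y \<in> carrier C. y \<sqsubseteq> x \<and> \<^bold>D y \<sqsubseteq> e} g \<Longrightarrow> left_restr C e x = g"
  unfolding left_restr_def by (rule the_equality) (auto intro: is_greatest_unique)

lemma right_restr_eq:
  "is_greatest C {y \<in> carrier C. y \<sqsubseteq> x \<and> \<^bold>R y \<sqsubseteq> e} g \<Longrightarrow> right_restr C x e = g"
  unfolding right_restr_def by (rule the_equality) (auto intro: is_greatest_unique)

lemma ident_meet_eq: "is_meet C e f g \<Longrightarrow> ident_meet C e f = g"
  unfolding ident_meet_def is_meet_def by (rule the_equality) (auto intro: is_greatest_unique)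

end

definition semigroup_of :: "'a ordered_category \<Rightarrow> 'a dr_semigroup" where
  "semigroup_of C = \<lparr>carrier = carrier C, dm = dm C, rg = rg C,
     mult = (\<lambda>s\<in>carrier C. \<lambda>t\<in>carrier C.
       let e = ident_meet C (rg C s) (dm C t)
       in the (pcomp C (right_restr C s e) (left_restr C e t)))\<rparr>"

lemma semigroup_of_simps [simp]:
  "carrier (semigroup_of C) = carrier C"
  "dm (semigroup_of C) = dm C"
  "rg (semigroup_of C) = rg C"
  by (auto simp: semigroup_of_def)

context ehresmann_ordered_category_OC4A
begin

abbreviation prod (infixl \<open>\<star>\<close> 70) where "s \<star> t \<equiv> mult (semigroup_of C) s t"

lemma closed [simp]:
  "s \<in> carrier C \<Longrightarrow> \<^bold>D s \<in> carrier C"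
  "s \<in> carrier C \<Longrightarrow> \<^bold>R s \<in> carrier C"
  using dm_funcset rg_funcset by auto

lemma dm_dm [simp]: "s \<in> carrier C \<Longrightarrow> \<^bold>D (\<^bold>D s) = \<^bold>D s"
  using dm_rg[of "\<^bold>D s"] by (simp add: rg_dm)

lemma idents_iff: "e \<in> idents C \<longleftrightarrow> e \<in> carrier C \<and> \<^bold>D e = e"
  unfolding idents_def by (auto intro: image_eqI[of e "dm C" e])

lemma dm_ident [simp]: "s \<in> carrier C \<Longrightarrow> \<^bold>D s \<in> idents C"
  by (simp add: idents_def)

lemma rg_ident [simp]: "s \<in> carrier C \<Longrightarrow> \<^bold>R s \<in> idents C"
  by (simp add: idents_iff dm_rg)

lemma ident_carrier [simp]: "e \<in> idents C \<Longrightarrow> e \<in> carrier C"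
  by (simp add: idents_iff)

lemma dm_of_ident [simp]: "e \<in> idents C \<Longrightarrow> \<^bold>D e = e"
  by (simp add: idents_iff)

lemma rg_of_ident [simp]: "e \<in> idents C \<Longrightarrow> \<^bold>R e = e"
  by (metis idents_iff rg_dm)

lemma left_restr:
  assumes "x \<in> carrier C" "e \<in> idents C" "e \<sqsubseteq> \<^bold>D x"
  shows "left_restr C e x \<sqsubseteq> x" "\<^bold>D (left_restr C e x) = e"
    and "y \<sqsubseteq> x \<Longrightarrow> \<^bold>D y \<sqsubseteq> e \<Longrightarrow> y \<sqsubseteq> left_restr C e x"
proof -
  obtain g where g: "is_greatest C {y \<in> carrier C. y \<sqsubseteq> x \<and> \<^bold>D y \<sqsubseteq> e} g" "\<^bold>D g = e"
    using OC6_left[OF assms] by auto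
  then have "left_restr C e x = g" by (simp add: left_restr_eq)
  with g show "left_restr C e x \<sqsubseteq> x" "\<^bold>D (left_restr C e x) = e"
    "y \<sqsubseteq> x \<Longrightarrow> \<^bold>D y \<sqsubseteq> e \<Longrightarrow> y \<sqsubseteq> left_restr C e x"
    using le_carrier[of y x] by (auto simp: is_greatest_def)
qed

lemma right_restr:
  assumes "x \<in> carrier C" "e \<in> idents C" "e \<sqsubseteq> \<^bold>R x"
  shows "right_restr C x e \<sqsubseteq> x" "\<^bold>R (right_restr C x e) = e"
    and "y \<sqsubseteq> x \<Longrightarrow> \<^bold>R y \<sqsubseteq> e \<Longrightarrow> y \<sqsubseteq> right_restr C x e"
proof -
  obtain g where g: "is_greatest C {y \<in> carrier C. y \<sqsubseteq> x \<and> \<^bold>R y \<sqsubseteq> e} g" "\<^bold>R g = e"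
    using OC6_right[OF assms] by auto
  then have "right_restr C x e = g" by (simp add: right_restr_eq)
  with g show "right_restr C x e \<sqsubseteq> x" "\<^bold>R (right_restr C x e) = e"
    "y \<sqsubseteq> x \<Longrightarrow> \<^bold>R y \<sqsubseteq> e \<Longrightarrow> y \<sqsubseteq> right_restr C x e"
    using le_carrier[of y x] by (auto simp: is_greatest_def)
qed

lemma ident_meet:
  assumes "e \<in> idents C" "f \<in> idents C"
  shows "ident_meet C e f \<in> idents C" "ident_meet C e f \<sqsubseteq> e" "ident_meet C e f \<sqsubseteq> f"
    and "h \<in> idents C \<Longrightarrow> h \<sqsubseteq> e \<Longrightarrow> h \<sqsubseteq> f \<Longrightarrow> h \<sqsubseteq> ident_meet C e f"
proof -
  obtain g where g: "is_meet C e f g" using meets[OF assms] by auto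
  then have "ident_meet C e f = g" by (rule ident_meet_eq)
  with g show "ident_meet C e f \<in> idents C" "ident_meet C e f \<sqsubseteq> e" "ident_meet C e f \<sqsubseteq> f"
    "h \<in> idents C \<Longrightarrow> h \<sqsubseteq> e \<Longrightarrow> h \<sqsubseteq> f \<Longrightarrow> h \<sqsubseteq> ident_meet C e f"
    by (auto simp: is_meet_def is_greatest_def)
qed

lemma ident_meet_commute:
  "e \<in> idents C \<Longrightarrow> f \<in> idents C \<Longrightarrow> ident_meet C e f = ident_meet C f e"
  by (auto intro!: le_antisym ident_meet)

text \<open>
  Under (OC4A) an element below \<open>x\<close> is determined by its domain: \<open>y \<le> x\<close> lies below \<open>D(y)|x\<close> and
  has the same domain.
\<close>

lemma le_imp_left_restr:
  assumes "y \<sqsubseteq> x"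
  shows "left_restr C (\<^bold>D y) x = y"
proof -
  have car: "x \<in> carrier C" "y \<in> carrier C" using assms le_carrier by auto
  have le: "\<^bold>D y \<sqsubseteq> \<^bold>D x" using assms by (rule dm_mono)
  have "y \<sqsubseteq> left_restr C (\<^bold>D y) x"
    using left_restr(3)[of x "\<^bold>D y" y] car le assms le_refl by simp
  then show ?thesis
    using OC4A left_restr(2)[of x "\<^bold>D y"] car le le_carrier dm_ident by metis
qed

lemma left_restr_ident: "f \<in> idents C \<Longrightarrow> e \<sqsubseteq> f \<Longrightarrow> left_restr C e f = e"
  using le_imp_left_restr[of e f] OCI le_carrier dm_of_ident by metis

lemma right_restr_ident:
  assumes "f \<in> idents C" "e \<sqsubseteq> f"
  shows "right_restr C f e = e"
proof -
  have e: "e \<in> idents C" using assms OCI le_carrier by blast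
  then have r: "right_restr C f e \<sqsubseteq> f" "\<^bold>R (right_restr C f e) = e"
    using right_restr[of f e] assms by simp_all
  then have "right_restr C f e \<in> idents C" using assms OCI le_carrier by blast
  with r show ?thesis by simp
qed

lemma pcomp_exists:
  assumes "x \<in> carrier C" "y \<in> carrier C" "\<^bold>R x = \<^bold>D y"
  obtains z where "x \<odot> y = Some z"
  using pcomp_defined assms by blast

lemma pcompD:
  assumes "x \<odot> y = Some z"
  shows "x \<in> carrier C" "y \<in> carrier C" "z \<in> carrier C" "\<^bold>R x = \<^bold>D y" "\<^bold>D z = \<^bold>D x" "\<^bold>R z = \<^bold>R y"
  using assms pcomp_carrier pcomp_defined[of x y] dm_pcomp rg_pcomp by auto

text \<open>
  The restrictions in the definition of \<open>s \<star> t\<close> are composable, as both meet in \<open>R(s) \<and> D(t)\<close>,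
  so the value of \<open>the\<close> there is the actual composite.
\<close>

lemma prod_pcomp:
  assumes "s \<in> carrier C" "t \<in> carrier C"
  defines "e \<equiv> ident_meet C (\<^bold>R s) (\<^bold>D t)"
  shows "right_restr C s e \<odot> left_restr C e t = Some (s \<star> t)"
proof -
  have e: "e \<in> idents C" "e \<sqsubseteq> \<^bold>R s" "e \<sqsubseteq> \<^bold>D t"
    using ident_meet[of "\<^bold>R s" "\<^bold>D t"] assms by simp_all
  have "right_restr C s e \<in> carrier C" "left_restr C e t \<in> carrier C"
    "\<^bold>R (right_restr C s e) = \<^bold>D (left_restr C e t)"
    using left_restr[of t e] right_restr[of s e] e assms le_carrier by auto
  then obtain z where "right_restr C s e \<odot> left_restr C e t = Some z"
    by (rule pcomp_exists)
  then show ?thesis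
    using assms by (simp add: semigroup_of_def Let_def)
qed

lemma prod_factors:
  assumes "s \<in> carrier C" "t \<in> carrier C"
  obtains p q where "p \<sqsubseteq> s" "q \<sqsubseteq> t" "p \<odot> q = Some (s \<star> t)"
proof -
  let ?e = "ident_meet C (\<^bold>R s) (\<^bold>D t)"
  have e: "?e \<in> idents C" "?e \<sqsubseteq> \<^bold>R s" "?e \<sqsubseteq> \<^bold>D t"
    using ident_meet[of "\<^bold>R s" "\<^bold>D t"] assms by simp_all
  show thesis
    using that prod_pcomp[OF assms] left_restr[of t ?e] right_restr[of s ?e] e assms by blast
qed

text \<open>
  Together with \<open>prod_factors\<close>, this says that \<open>s \<star> t\<close> is the greatest composite \<open>p \<circ> q\<close> with
  \<open>p \<le> s\<close> and \<open>q \<le> t\<close>. The identity \<open>R(p) = D(q)\<close> at which \<open>p\<close> and \<open>q\<close> meet lies below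
  \<open>R(s) \<and> D(t)\<close>, so \<open>p\<close> and \<open>q\<close> lie below the restrictions of \<open>s\<close> and \<open>t\<close> to that meet.
\<close>

lemma pcomp_le_prod:
  assumes "p \<sqsubseteq> s" "q \<sqsubseteq> t" "p \<odot> q = Some r"
  shows "r \<sqsubseteq> s \<star> t"
proof -
  let ?e = "ident_meet C (\<^bold>R s) (\<^bold>D t)"
  have car: "s \<in> carrier C" "t \<in> carrier C" using assms le_carrier by auto
  have e: "?e \<in> idents C" "?e \<sqsubseteq> \<^bold>R s" "?e \<sqsubseteq> \<^bold>D t"
    using ident_meet[of "\<^bold>R s" "\<^bold>D t"] car by simp_all
  have "\<^bold>R p = \<^bold>D q" "\<^bold>R p \<in> idents C" using pcompD[OF assms(3)] by auto
  moreover from this have "\<^bold>R p \<sqsubseteq> ?e"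
    using ident_meet(4)[of "\<^bold>R s" "\<^bold>D t" "\<^bold>R p"] car assms rg_mono[of p s] dm_mono[of q t] by simp
  ultimately have "p \<sqsubseteq> right_restr C s ?e" "q \<sqsubseteq> left_restr C ?e t"
    using right_restr(3)[of s ?e p] left_restr(3)[of t ?e q] car e assms by simp_all
  then show ?thesis
    using pcomp_mono assms(3) prod_pcomp[OF car] by blast
qed

lemma prod_closed [simp]:
  "s \<in> carrier C \<Longrightarrow> t \<in> carrier C \<Longrightarrow> s \<star> t \<in> carrier C"
  using prod_pcomp pcompD(3) by blast

lemma pcomp_eq_prod:
  assumes "s \<odot> t = Some r"
  shows "s \<star> t = r"
proof (rule le_antisym)
  have car: "s \<in> carrier C" "t \<in> carrier C" using pcompD[OF assms] by auto
  then show "r \<sqsubseteq> s \<star> t" using pcomp_le_prod le_refl assms by blast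
  obtain p q where "p \<sqsubseteq> s" "q \<sqsubseteq> t" "p \<odot> q = Some (s \<star> t)"
    using prod_factors[OF car] .
  then show "s \<star> t \<sqsubseteq> r" using pcomp_mono assms by blast
qed

text \<open>
  (OC7') provides a composite \<open>b' \<circ> c'\<close> above \<open>a\<close> with the same domain as \<open>a\<close>; by (OC4A) it
  equals \<open>a\<close>.
\<close>

lemma le_pcomp_factors:
  assumes "b \<odot> c = Some d" "a \<sqsubseteq> d"
  obtains b' c' where "b' \<sqsubseteq> b" "c' \<sqsubseteq> c" "b' \<odot> c' = Some a"
proof -
  obtain b' c' d' where *: "b' \<sqsubseteq> b" "c' \<sqsubseteq> c" "\<^bold>D a = \<^bold>D b'" "b' \<odot> c' = Some d'" "a \<sqsubseteq> d'"
    using OC7'[OF assms] by blast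
  then have "a = d'" using OC4A pcompD(5) le_carrier by metis
  with * show thesis using that by blast
qed

lemma le_prod_factors:
  assumes "s \<in> carrier C" "t \<in> carrier C" "a \<sqsubseteq> s \<star> t"
  obtains p q where "p \<sqsubseteq> s" "q \<sqsubseteq> t" "p \<odot> q = Some a"
proof -
  obtain p q where *: "p \<sqsubseteq> s" "q \<sqsubseteq> t" "p \<odot> q = Some (s \<star> t)"
    using prod_factors[OF assms(1,2)] .
  obtain p' q' where "p' \<sqsubseteq> p" "q' \<sqsubseteq> q" "p' \<odot> q' = Some a"
    using le_pcomp_factors[OF *(3) assms(3)] .
  then show thesis using that * le_trans by blast
qed

text \<open>
  Both sides are the greatest composite \<open>p \<circ> q \<circ> r\<close> with \<open>p \<le> s\<close>, \<open>q \<le> t\<close>, \<open>r \<le> u\<close>. Each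
  inequality writes one side as such a composite, rebrackets it in the category, and applies
  \<open>pcomp_le_prod\<close> twice.
\<close>

lemma prod_assoc:
  assumes "s \<in> carrier C" "t \<in> carrier C" "u \<in> carrier C"
  shows "(s \<star> t) \<star> u = s \<star> (t \<star> u)"
proof (rule le_antisym)
  obtain a r where ar: "a \<sqsubseteq> s \<star> t" "r \<sqsubseteq> u" "a \<odot> r = Some ((s \<star> t) \<star> u)"
    using prod_factors[of "s \<star> t" u] assms by auto
  obtain p q where pq: "p \<sqsubseteq> s" "q \<sqsubseteq> t" "p \<odot> q = Some a"
    using le_prod_factors[OF assms(1,2) ar(1)] .
  obtain w where w: "q \<odot> r = Some w"
    using pcomp_exists[of q r] pcompD[OF ar(3)] pcompD[OF pq(3)] by auto
  obtain v where v: "p \<odot> w = Some v"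
    using pcomp_exists[of p w] pcompD[OF w] pcompD[OF pq(3)] by auto
  have "v \<sqsubseteq> s \<star> (t \<star> u)"
    using pcomp_le_prod[OF pq(1) pcomp_le_prod[OF pq(2) ar(2) w] v] .
  then show "(s \<star> t) \<star> u \<sqsubseteq> s \<star> (t \<star> u)"
    using pcomp_assoc[OF pq(3) ar(3) w v] by simp
next
  obtain p a where pa: "p \<sqsubseteq> s" "a \<sqsubseteq> t \<star> u" "p \<odot> a = Some (s \<star> (t \<star> u))"
    using prod_factors[of s "t \<star> u"] assms by auto
  obtain q r where qr: "q \<sqsubseteq> t" "r \<sqsubseteq> u" "q \<odot> r = Some a"
    using le_prod_factors[OF assms(2,3) pa(2)] .
  obtain w where w: "p \<odot> q = Some w"
    using pcomp_exists[of p q] pcompD[OF pa(3)] pcompD[OF qr(3)] by auto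
  obtain v where v: "w \<odot> r = Some v"
    using pcomp_exists[of w r] pcompD[OF w] pcompD[OF qr(3)] by auto
  have "v \<sqsubseteq> (s \<star> t) \<star> u"
    using pcomp_le_prod[OF pcomp_le_prod[OF pa(1) qr(1) w] qr(2) v] .
  then show "s \<star> (t \<star> u) \<sqsubseteq> (s \<star> t) \<star> u"
    using pcomp_assoc[OF w v qr(3) pa(3)] by simp
qed

text \<open>
  A restriction of an identity is an identity, so in the composite \<open>(e|g) \<circ> (g|t)\<close> that defines
  \<open>e \<star> t\<close> the first factor can be dropped. Likewise for the second factor in \<open>prod_ident\<close>.
\<close>

lemma ident_prod:
  assumes "e \<in> idents C" "t \<in> carrier C"
  shows "e \<star> t = left_restr C (ident_meet C e (\<^bold>D t)) t"
proof -
  let ?g = "ident_meet C e (\<^bold>D t)"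
  have g: "?g \<in> idents C" "?g \<sqsubseteq> e" "?g \<sqsubseteq> \<^bold>D t" using ident_meet assms by simp_all
  have "right_restr C e ?g = ?g" using right_restr_ident assms g by simp
  then have "?g \<odot> left_restr C ?g t = Some (e \<star> t)"
    using prod_pcomp[of e t] assms by simp
  moreover have "?g \<odot> left_restr C ?g t = Some (left_restr C ?g t)"
    using dm_left[of "left_restr C ?g t"] left_restr[of t ?g] assms g le_carrier by auto
  ultimately show ?thesis by simp
qed

lemma prod_ident:
  assumes "s \<in> carrier C" "f \<in> idents C"
  shows "s \<star> f = right_restr C s (ident_meet C (\<^bold>R s) f)"
proof -
  let ?g = "ident_meet C (\<^bold>R s) f"
  have g: "?g \<in> idents C" "?g \<sqsubseteq> \<^bold>R s" "?g \<sqsubseteq> f" using ident_meet assms by simp_all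
  have "left_restr C ?g f = ?g" using left_restr_ident assms g by simp
  then have "right_restr C s ?g \<odot> ?g = Some (s \<star> f)"
    using prod_pcomp[of s f] assms by simp
  moreover have "right_restr C s ?g \<odot> ?g = Some (right_restr C s ?g)"
    using rg_right[of "right_restr C s ?g"] right_restr[of s ?g] assms g le_carrier by auto
  ultimately show ?thesis by simp
qed

lemma ident_prod_ident:
  assumes "e \<in> idents C" "f \<in> idents C"
  shows "e \<star> f = ident_meet C e f"
  using ident_prod[of e f] left_restr_ident[of f "ident_meet C e f"] ident_meet[OF assms] assms
  by simp

lemma le_imp_ident_prod:
  assumes "y \<sqsubseteq> x"
  shows "\<^bold>D y \<star> x = y"
proof -
  have car: "x \<in> carrier C" "y \<in> carrier C" using assms le_carrier by auto
  have "ident_meet C (\<^bold>D y) (\<^bold>D x) = \<^bold>D y"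
    using car dm_mono[OF assms] by (intro le_antisym ident_meet) (auto intro: le_refl)
  then show ?thesis
    using car le_imp_left_restr[OF assms] by (simp add: ident_prod)
qed

text \<open>
  The order of the category is the natural order of its semigroup, so it can be recovered from
  the multiplication.
\<close>

lemma le_iff_prod: "y \<sqsubseteq> x \<longleftrightarrow> y \<in> carrier C \<and> x \<in> carrier C \<and> y = \<^bold>D y \<star> x"
proof
  assume "y \<sqsubseteq> x"
  then show "y \<in> carrier C \<and> x \<in> carrier C \<and> y = \<^bold>D y \<star> x"
    using le_imp_ident_prod le_carrier by auto
next
  assume *: "y \<in> carrier C \<and> x \<in> carrier C \<and> y = \<^bold>D y \<star> x"
  then have "\<^bold>D y \<in> idents C" "x \<in> carrier C" by simp_all
  then have "\<^bold>D y \<star> x \<sqsubseteq> x"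
    using left_restr(1)[of x "ident_meet C (\<^bold>D y) (\<^bold>D x)"] ident_meet[of "\<^bold>D y" "\<^bold>D x"]
    by (simp add: ident_prod)
  with * show "y \<sqsubseteq> x" by metis
qed

lemma semigroup_of_left_restriction:
  "left_restriction_semigroup_with_range (semigroup_of C)"
proof unfold_locales
  show "mult (semigroup_of C) \<in> carrier (semigroup_of C) \<rightarrow>\<^sub>E
      carrier (semigroup_of C) \<rightarrow>\<^sub>E carrier (semigroup_of C)"
  proof (intro PiE_I)
    fix s t assume "s \<in> carrier (semigroup_of C)" "t \<in> carrier (semigroup_of C)"
    then show "s \<star> t \<in> carrier (semigroup_of C)" by simp
  qed (auto simp: semigroup_of_def)
next
  fix s t assume "s \<in> carrier (semigroup_of C)" "t \<in> carrier (semigroup_of C)"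
  then have car: "s \<in> carrier C" "t \<in> carrier C" by auto
  have D: "\<^bold>D (s \<star> t) = \<^bold>D (right_restr C s (ident_meet C (\<^bold>R s) (\<^bold>D t)))"
    using pcompD(5)[OF prod_pcomp] car by blast
  have R: "\<^bold>R (s \<star> t) = \<^bold>R (left_restr C (ident_meet C (\<^bold>R s) (\<^bold>D t)) t)"
    using pcompD(6)[OF prod_pcomp] car by blast
  have sD: "s \<star> \<^bold>D t = right_restr C s (ident_meet C (\<^bold>R s) (\<^bold>D t))"
    using car by (simp add: prod_ident)
  show "\<^bold>D\<^bsub>semigroup_of C\<^esub> (s \<star> t) = \<^bold>D\<^bsub>semigroup_of C\<^esub> (s \<star> \<^bold>D\<^bsub>semigroup_of C\<^esub> t)"
    using D sD by simp
  show "\<^bold>R\<^bsub>semigroup_of C\<^esub> (s \<star> t) = \<^bold>R\<^bsub>semigroup_of C\<^esub> (\<^bold>R\<^bsub>semigroup_of C\<^esub> s \<star> t)"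
    using R car by (simp add: ident_prod)
  show "\<^bold>D\<^bsub>semigroup_of C\<^esub> (\<^bold>D\<^bsub>semigroup_of C\<^esub> s \<star> \<^bold>D\<^bsub>semigroup_of C\<^esub> t) =
      \<^bold>D\<^bsub>semigroup_of C\<^esub> s \<star> \<^bold>D\<^bsub>semigroup_of C\<^esub> t"
    using car ident_meet(1)[of "\<^bold>D s" "\<^bold>D t"] by (simp add: ident_prod_ident)
  show "\<^bold>D\<^bsub>semigroup_of C\<^esub> s \<star> \<^bold>D\<^bsub>semigroup_of C\<^esub> t =
      \<^bold>D\<^bsub>semigroup_of C\<^esub> t \<star> \<^bold>D\<^bsub>semigroup_of C\<^esub> s"
    using car ident_meet_commute[of "\<^bold>D s" "\<^bold>D t"] by (simp add: ident_prod_ident)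
  \<comment> \<open>The left restriction law: \<open>s \<star> D(t)\<close> is a restriction of \<open>s\<close> with domain \<open>D(s \<star> t)\<close>, and there
    is only one such element below \<open>s\<close>.\<close>
  have "s \<star> \<^bold>D t \<sqsubseteq> s"
    using right_restr(1)[of s "ident_meet C (\<^bold>R s) (\<^bold>D t)"] ident_meet[of "\<^bold>R s" "\<^bold>D t"] car sD
    by simp
  then show "s \<star> \<^bold>D\<^bsub>semigroup_of C\<^esub> t = \<^bold>D\<^bsub>semigroup_of C\<^esub> (s \<star> t) \<star> s"
    using le_imp_ident_prod[of "s \<star> \<^bold>D t" s] D sD by simp
qed (use dm_funcset rg_funcset in
    \<open>auto simp: prod_assoc dm_rg rg_dm intro: pcomp_eq_prod dm_left rg_right\<close>)

lemma category_of_semigroup_of: "category_of (semigroup_of C) = C"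
proof -
  have "pcomp (category_of (semigroup_of C)) s t = s \<odot> t" for s t
  proof (cases "s \<odot> t")
    case None
    then have "\<not> (s \<in> carrier C \<and> t \<in> carrier C \<and> \<^bold>R s = \<^bold>D t)"
      using pcomp_defined by blast
    then show ?thesis using None by (auto simp: category_of_def)
  next
    case (Some r)
    then show ?thesis using pcompD[OF Some] pcomp_eq_prod[OF Some] by simp
  qed
  moreover have "le (category_of (semigroup_of C)) s t = (s \<sqsubseteq> t)" for s t
    using le_iff_prod[of s t] by simp
  ultimately show ?thesis
    by (intro ordered_category.equality) (auto simp: fun_eq_iff simp del: category_of_simps(4,5,6))
qed

end

section \<open>Semigroups and their morphisms recovered from the category\<close>

context left_restriction_semigroup_with_range
begin

lemma left_restr_category_of:
  assumes "x \<in> carrier S" "e \<in> carrier S" "\<^bold>D e = e" "e \<cdot> \<^bold>D x = e"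
  shows "left_restr (category_of S) e x = e \<cdot> x"
  using omega_structured_category.left_restr_eq[OF omega_structured_category_of, of x e]
    greatest_left[OF assms] by simp

lemma right_restr_category_of:
  assumes "x \<in> carrier S" "e \<in> carrier S" "\<^bold>D e = e" "e \<cdot> \<^bold>R x = e"
  shows "right_restr (category_of S) x e = x \<cdot> e"
  using omega_structured_category.right_restr_eq[OF omega_structured_category_of, of x e]
    greatest_right[OF assms] by simp

lemma ident_meet_category_of:
  assumes "e \<in> carrier S" "\<^bold>D e = e" "f \<in> carrier S" "\<^bold>D f = f"
  shows "ident_meet (category_of S) e f = e \<cdot> f"
  by (rule omega_structured_category.ident_meet_eq
      [OF omega_structured_category_of is_meet_mult[OF assms]])

text \<open>
  This is \<open>mult_via_meet\<close> in terms of the category alone. It recovers the multiplication of \<open>S\<close>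
  from \<open>category_of S\<close>, and shows that functors preserve it.
\<close>

lemma restr_meet:
  assumes "s \<in> carrier S" "t \<in> carrier S"
  defines "e \<equiv> ident_meet (category_of S) (\<^bold>R s) (\<^bold>D t)"
  shows "e \<in> carrier S" "\<^bold>D e = e" "e \<cdot> \<^bold>R s = e" "e \<cdot> \<^bold>D t = e"
    and "right_restr (category_of S) s e \<odot>\<^bsub>category_of S\<^esub> left_restr (category_of S) e t =
      Some (s \<cdot> t)"
proof -
  have e: "e = \<^bold>R s \<cdot> \<^bold>D t"
    unfolding e_def using assms by (intro ident_meet_category_of) (auto simp: dm_rg)
  have R: "\<^bold>D (\<^bold>R s) = \<^bold>R s" "\<^bold>D (\<^bold>D t) = \<^bold>D t" "\<^bold>R s \<in> carrier S" "\<^bold>D t \<in> carrier S"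
    using assms by (auto simp: dm_rg)
  show 1: "e \<in> carrier S" "\<^bold>D e = e" "e \<cdot> \<^bold>R s = e" "e \<cdot> \<^bold>D t = e"
    unfolding e using R by (simp, metis dm_dm_mult, metis assoc proj_commute proj_idem,
      metis assoc proj_idem)
  have "right_restr (category_of S) s e = s \<cdot> e" "left_restr (category_of S) e t = e \<cdot> t"
    using 1 assms by (simp_all add: left_restr_category_of right_restr_category_of)
  moreover have "\<^bold>R (s \<cdot> e) = \<^bold>D (e \<cdot> t)"
    using 1 assms greatest_right[of s e] greatest_left[of t e] by simp
  ultimately show "right_restr (category_of S) s e \<odot>\<^bsub>category_of S\<^esub>
      left_restr (category_of S) e t = Some (s \<cdot> t)"
    using 1 assms mult_via_meet[of s t] e by simp
qed

lemma semigroup_of_category_of: "semigroup_of (category_of S) = S"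
proof -
  let ?S = "semigroup_of (category_of S)"
  interpret S': left_restriction_semigroup_with_range ?S
    using ehresmann_ordered_category_of
    by (rule ehresmann_ordered_category_OC4A.semigroup_of_left_restriction)
  have funcset: "mult ?S \<in> carrier S \<rightarrow>\<^sub>E carrier S \<rightarrow>\<^sub>E carrier S"
    using S'.mult_funcset by simp
  have eq: "mult ?S s t = s \<cdot> t" if "s \<in> carrier S" "t \<in> carrier S" for s t
    using that restr_meet(5)[OF that]
    by (simp add: semigroup_of_def Let_def del: category_of_simps(4))
  have "mult ?S s = mult S s" if "s \<in> carrier S" for s
    using PiE_mem[OF funcset that] PiE_mem[OF mult_funcset that]
    by (rule PiE_ext) (rule eq[OF that])
  with funcset mult_funcset have "mult ?S = mult S"
    by (rule PiE_ext)
  then show ?thesis by (intro dr_semigroup.equality) auto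
qed

end

text \<open>
  Order, meets and restrictions in \<open>category_of S\<close> are given by products with projections, so
  homomorphisms preserve them. Conversely, a functor preserves the composite of restrictions
  that equals \<open>s \<cdot> t\<close>.
\<close>

lemma ehresmann_functors_category_of:
  assumes "left_restriction_semigroup_with_range S" "left_restriction_semigroup_with_range T"
  shows "ehresmann_functors (category_of S) (category_of T) = ehresmann_hom S T"
proof -
  interpret S: left_restriction_semigroup_with_range S by fact
  interpret T: left_restriction_semigroup_with_range T by fact
  show ?thesis
  proof (intro set_eqI iffI)
    fix F assume F: "F \<in> ehresmann_hom S T"
    then have funcset: "F \<in> carrier S \<rightarrow>\<^sub>E carrier T"
      and mult: "\<And>s t. s \<in> carrier S \<Longrightarrow> t \<in> carrier S \<Longrightarrow> F (s \<cdot>\<^bsub>S\<^esub> t) = F s \<cdot>\<^bsub>T\<^esub> F t"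
      and dm: "\<And>s. s \<in> carrier S \<Longrightarrow> \<^bold>D\<^bsub>T\<^esub> (F s) = F (\<^bold>D\<^bsub>S\<^esub> s)"
      and rg: "\<And>s. s \<in> carrier S \<Longrightarrow> \<^bold>R\<^bsub>T\<^esub> (F s) = F (\<^bold>R\<^bsub>S\<^esub> s)"
      by (auto simp: ehresmann_hom_def)
    have car: "F s \<in> carrier T" if "s \<in> carrier S" for s using funcset that by auto
    have meet: "F (ident_meet (category_of S) e f) = ident_meet (category_of T) (F e) (F f)"
      if "e \<in> carrier S" "\<^bold>D\<^bsub>S\<^esub> e = e" "f \<in> carrier S" "\<^bold>D\<^bsub>S\<^esub> f = f" for e f
      using that by (simp add: S.ident_meet_category_of T.ident_meet_category_of car dm mult)
    have left: "F (left_restr (category_of S) e s) = left_restr (category_of T) (F e) (F s)"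
      if *: "s \<in> carrier S" "e \<in> carrier S" "\<^bold>D\<^bsub>S\<^esub> e = e" "e \<cdot>\<^bsub>S\<^esub> \<^bold>D\<^bsub>S\<^esub> s = e" for s e
    proof -
      have "F e \<cdot>\<^bsub>T\<^esub> F (\<^bold>D\<^bsub>S\<^esub> s) = F e" using * by (metis mult S.closed(1))
      with * show ?thesis
        by (simp add: S.left_restr_category_of T.left_restr_category_of car dm mult)
    qed
    have right: "F (right_restr (category_of S) s e) = right_restr (category_of T) (F s) (F e)"
      if *: "s \<in> carrier S" "e \<in> carrier S" "\<^bold>D\<^bsub>S\<^esub> e = e" "e \<cdot>\<^bsub>S\<^esub> \<^bold>R\<^bsub>S\<^esub> s = e" for s e
    proof -
      have "F e \<cdot>\<^bsub>T\<^esub> F (\<^bold>R\<^bsub>S\<^esub> s) = F e" using * by (metis mult S.closed(2))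
      with * show ?thesis
        by (simp add: S.right_restr_category_of T.right_restr_category_of car dm rg mult)
    qed
    have mono: "F s = F (\<^bold>D\<^bsub>S\<^esub> s) \<cdot>\<^bsub>T\<^esub> F t"
      if "s \<in> carrier S" "t \<in> carrier S" "s = \<^bold>D\<^bsub>S\<^esub> s \<cdot>\<^bsub>S\<^esub> t" for s t
      using that by (metis mult S.closed(1))
    show "F \<in> ehresmann_functors (category_of S) (category_of T)"
      unfolding ehresmann_functors_def
      by (auto simp: S.proj_iff funcset car dm rg mult intro: meet left right mono
          simp del: image_iff)
  next
    fix F assume F: "F \<in> ehresmann_functors (category_of S) (category_of T)"
    then have funcset: "F \<in> carrier S \<rightarrow>\<^sub>E carrier T"
      and dm: "\<And>s. s \<in> carrier S \<Longrightarrow> F (\<^bold>D\<^bsub>S\<^esub> s) = \<^bold>D\<^bsub>T\<^esub> (F s)"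
      and rg: "\<And>s. s \<in> carrier S \<Longrightarrow> F (\<^bold>R\<^bsub>S\<^esub> s) = \<^bold>R\<^bsub>T\<^esub> (F s)"
      and pcomp: "\<And>s t u. s \<odot>\<^bsub>category_of S\<^esub> t = Some u \<Longrightarrow>
        F s \<odot>\<^bsub>category_of T\<^esub> F t = Some (F u)"
      and meet: "\<And>e f. e \<in> idents (category_of S) \<Longrightarrow> f \<in> idents (category_of S) \<Longrightarrow>
        F (ident_meet (category_of S) e f) = ident_meet (category_of T) (F e) (F f)"
      and left: "\<And>s e. s \<in> carrier S \<Longrightarrow> e \<in> idents (category_of S) \<Longrightarrow>
        e \<sqsubseteq>\<^bsub>category_of S\<^esub> \<^bold>D\<^bsub>S\<^esub> s \<Longrightarrow>
        F (left_restr (category_of S) e s) = left_restr (category_of T) (F e) (F s)"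
      and right: "\<And>s e. s \<in> carrier S \<Longrightarrow> e \<in> idents (category_of S) \<Longrightarrow>
        e \<sqsubseteq>\<^bsub>category_of S\<^esub> \<^bold>R\<^bsub>S\<^esub> s \<Longrightarrow>
        F (right_restr (category_of S) s e) = right_restr (category_of T) (F s) (F e)"
      unfolding ehresmann_functors_def category_of_simps(1,2,3) by blast+
    have "F (s \<cdot>\<^bsub>S\<^esub> t) = F s \<cdot>\<^bsub>T\<^esub> F t" if st: "s \<in> carrier S" "t \<in> carrier S" for s t
    proof -
      let ?e = "ident_meet (category_of S) (\<^bold>R\<^bsub>S\<^esub> s) (\<^bold>D\<^bsub>S\<^esub> t)"
      let ?f = "ident_meet (category_of T) (\<^bold>R\<^bsub>T\<^esub> (F s)) (\<^bold>D\<^bsub>T\<^esub> (F t))"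
      have F_st: "F s \<in> carrier T" "F t \<in> carrier T" using funcset st by auto
      have "\<^bold>R\<^bsub>S\<^esub> s \<in> idents (category_of S)" "\<^bold>D\<^bsub>S\<^esub> t \<in> idents (category_of S)"
        using st unfolding category_of_simps(7) S.proj_iff by (auto simp: S.dm_rg)
      then have e: "F ?e = ?f" using meet st dm rg by simp
      have "?e \<in> idents (category_of S)" "?e \<sqsubseteq>\<^bsub>category_of S\<^esub> \<^bold>R\<^bsub>S\<^esub> s" "?e \<sqsubseteq>\<^bsub>category_of S\<^esub> \<^bold>D\<^bsub>S\<^esub> t"
        unfolding category_of_simps(6,7) S.proj_iff
        using S.restr_meet[OF st] st by auto
      then have "F (right_restr (category_of S) s ?e) = right_restr (category_of T) (F s) ?f"
        "F (left_restr (category_of S) ?e t) = left_restr (category_of T) ?f (F t)"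
        using left right st e by metis+
      then have "Some (F (s \<cdot>\<^bsub>S\<^esub> t)) = Some (F s \<cdot>\<^bsub>T\<^esub> F t)"
        using pcomp[OF S.restr_meet(5)[OF st]] T.restr_meet(5)[OF F_st] by metis
      then show ?thesis by simp
    qed
    then show "F \<in> ehresmann_hom S T"
      using funcset dm rg by (simp add: ehresmann_hom_def)
  qed
qed

section \<open>The isomorphism of categories\<close>

lemma category_structure_cat:
  assumes funcset: "\<And>S T. S \<in> obs \<Longrightarrow> T \<in> obs \<Longrightarrow> hom S T \<subseteq> carrier S \<rightarrow>\<^sub>E carrier T"
    and ident: "\<And>S. S \<in> obs \<Longrightarrow> restrict (\<lambda>x. x) (carrier S) \<in> hom S S"
    and comp: "\<And>S T U F G. S \<in> obs \<Longrightarrow> T \<in> obs \<Longrightarrow> U \<in> obs \<Longrightarrow> F \<in> hom S T \<Longrightarrow> G \<in> hom T U \<Longrightarrow>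
      compose (carrier S) G F \<in> hom S U"
  shows "category (structure_cat obs hom)"
proof unfold_locales
  fix f assume "f \<in> Arr (structure_cat obs hom)"
  then obtain S F T where f: "f = (S, F, T)" "S \<in> obs" "T \<in> obs" "F \<in> carrier S \<rightarrow>\<^sub>E carrier T"
    using funcset by (fastforce simp: structure_cat_def)
  then have "compose (carrier S) F (\<lambda>x\<in>carrier S. x) = F"
    "compose (carrier S) (\<lambda>x\<in>carrier T. x) F = F"
    by (auto simp: compose_def fun_eq_iff PiE_def extensional_def Pi_iff)
  with f show "Comp (structure_cat obs hom)
      (Ide (structure_cat obs hom) (Dom (structure_cat obs hom) f)) f = f"
    "Comp (structure_cat obs hom) f
      (Ide (structure_cat obs hom) (Cod (structure_cat obs hom) f)) = f"
    by (auto simp: structure_cat_def)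
next
  fix f g h
  assume "f \<in> Arr (structure_cat obs hom)" "g \<in> Arr (structure_cat obs hom)"
    "h \<in> Arr (structure_cat obs hom)"
    "Cod (structure_cat obs hom) f = Dom (structure_cat obs hom) g"
    "Cod (structure_cat obs hom) g = Dom (structure_cat obs hom) h"
  then show "Comp (structure_cat obs hom) (Comp (structure_cat obs hom) f g) h =
      Comp (structure_cat obs hom) f (Comp (structure_cat obs hom) g h)"
    using funcset by (fastforce simp: structure_cat_def compose_def fun_eq_iff)
qed (auto simp: structure_cat_def ident comp)

text \<open>
  A bijection between two classes of structures that fixes carriers and for which the two notions
  of morphism have the same underlying maps is an isomorphism of categories. Identities and
  composition depend only on the carriers, so the second category inherits its laws from the first.
\<close>

lemma structure_cat_isomorphism:
  assumes cat: "category (structure_cat obs hom)"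
    and Fo: "\<And>S. S \<in> obs \<Longrightarrow> Fo S \<in> obs'" "\<And>S. S \<in> obs \<Longrightarrow> Go (Fo S) = S"
    and Go: "\<And>C. C \<in> obs' \<Longrightarrow> Go C \<in> obs" "\<And>C. C \<in> obs' \<Longrightarrow> Fo (Go C) = C"
    and carrier: "\<And>S. S \<in> obs \<Longrightarrow> carrier (Fo S) = carrier S"
    and hom: "\<And>S T. S \<in> obs \<Longrightarrow> T \<in> obs \<Longrightarrow> hom' (Fo S) (Fo T) = hom S T"
  shows "category_isomorphism (structure_cat obs hom) (structure_cat obs' hom')
    Fo (\<lambda>(S, F, T). (Fo S, F, Fo T)) Go (\<lambda>(C, F, D). (Go C, F, Go D))"
proof -
  interpret A: category "structure_cat obs hom" by fact
  let ?B = "structure_cat obs' hom'"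
  have hom': "hom' C D = hom (Go C) (Go D)" if "C \<in> obs'" "D \<in> obs'" for C D
    using that hom[of "Go C" "Go D"] Go by simp
  have carrier': "carrier C = carrier (Go C)" if "C \<in> obs'" for C
    using that carrier[of "Go C"] Go by simp
  have comp: "compose (carrier C) G F \<in> hom' C E"
    if "C \<in> obs'" "D \<in> obs'" "E \<in> obs'" "F \<in> hom' C D" "G \<in> hom' D E" for C D E F G
    using A.Comp_Arr[of "(Go C, F, Go D)" "(Go D, G, Go E)"] that
    by (simp add: structure_cat_def Go hom' carrier')
  have "category ?B"
  proof unfold_locales
    fix X assume "X \<in> Obj ?B"
    then have "X \<in> obs'" by (simp add: structure_cat_def)
    then show "Ide ?B X \<in> Arr ?B"
      using A.Ide_Arr[of "Go X"] by (simp add: structure_cat_def Go hom' carrier')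
  next
    fix f assume "f \<in> Arr ?B"
    then obtain C F D where f: "f = (C, F, D)" "C \<in> obs'" "D \<in> obs'" "F \<in> hom' C D"
      by (auto simp: structure_cat_def)
    then show "Comp ?B (Ide ?B (Dom ?B f)) f = f" "Comp ?B f (Ide ?B (Cod ?B f)) = f"
      using A.Comp_Ide_left[of "(Go C, F, Go D)"] A.Comp_Ide_right[of "(Go C, F, Go D)"]
      by (auto simp: structure_cat_def Go hom' carrier')
  next
    fix f g h
    assume *: "f \<in> Arr ?B" "g \<in> Arr ?B" "h \<in> Arr ?B"
      "Cod ?B f = Dom ?B g" "Cod ?B g = Dom ?B h"
    then obtain C F D G E H I where "f = (C, F, D)" "g = (D, G, E)" "h = (E, H, I)"
      by (auto simp: structure_cat_def)
    with * show "Comp ?B (Comp ?B f g) h = Comp ?B f (Comp ?B g h)"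
      using A.Comp_assoc[of "(Go C, F, Go D)" "(Go D, G, Go E)" "(Go E, H, Go I)"]
      by (auto simp: structure_cat_def Go hom' carrier')
  qed (auto simp: structure_cat_def comp)
  then interpret B: category ?B .
  show ?thesis
    by unfold_locales (auto simp: structure_cat_def Fo Go carrier hom hom' carrier'[symmetric])
qed

theorem corollary4p12:
  shows "\<exists>Fo Fa Go Ga. category_isomorphism
    (left_restriction_semigroups_with_range :: 'a lrsr_cat)
    (ehresmann_ordered_categories_OC4A :: 'a eoc_cat)
    Fo Fa Go Ga"
proof -
  let ?obs = "{S :: 'a dr_semigroup. left_restriction_semigroup_with_range S}"
  have "category (structure_cat ?obs ehresmann_hom)"
  proof (rule category_structure_cat)
    fix S T :: "'a dr_semigroup"
    show "ehresmann_hom S T \<subseteq> carrier S \<rightarrow>\<^sub>E carrier T"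
      by (auto simp: ehresmann_hom_def)
  next
    fix S :: "'a dr_semigroup" assume "S \<in> ?obs"
    then interpret left_restriction_semigroup_with_range S by simp
    show "restrict (\<lambda>x. x) (carrier S) \<in> ehresmann_hom S S"
      by (auto simp: ehresmann_hom_def)
  next
    fix S T U :: "'a dr_semigroup" and F G
    assume "S \<in> ?obs" and hom: "F \<in> ehresmann_hom S T" "G \<in> ehresmann_hom T U"
    then interpret left_restriction_semigroup_with_range S by simp
    have "F s \<in> carrier T" if "s \<in> carrier S" for s
      using hom that by (auto simp: ehresmann_hom_def)
    with hom show "compose (carrier S) G F \<in> ehresmann_hom S U"
      by (auto simp: ehresmann_hom_def compose_def)
  qed
  then show ?thesis
    unfolding left_restriction_semigroups_with_range_def ehresmann_ordered_categories_OC4A_def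
    by (intro exI, rule structure_cat_isomorphism[where Fo = category_of and Go = semigroup_of])
      (simp_all add: left_restriction_semigroup_with_range.ehresmann_ordered_category_of
        left_restriction_semigroup_with_range.semigroup_of_category_of
        ehresmann_ordered_category_OC4A.semigroup_of_left_restriction
        ehresmann_ordered_category_OC4A.category_of_semigroup_of
        ehresmann_functors_category_of)
qed

end
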